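(* Let $P$ be a (nonempty) poset and $\to$ a total binary operation on $P$. Then $(P,\to)$ is a normal ESP-poset if and only if the following conditions hold for all $x,y,z\in P$: (0) $y\le x\to y$; (1) if $x\le y\to z$, then $y\le x\to z$; (2) if $y\le x\le x\to y$, then $x\le y$; (3) if $z$ is a maximal lower bound of $x$ and $y$, then $x\le y\to z$. Moreover, condition (0) may be replaced by the requirement that $P$ has a greatest element; that is, $(P,\to)$ is a normal ESP-poset if and only if $P$ has a greatest element and (1), (2), (3) hold.
   Context: For a poset $P$ and $y\in P$ put $[y)=\{u\in P: y\le u\}$. For $y\le x$, the pseudocomplement $x*y$ of $x$ in $[y)$ is the greatest $u\in[y)$ such that $y$ is the only common lower bound of $u$ and $x$ belonging to $[y)$. The poset $P$ is sectionally pseudocomplemented if $x*y$ exists for all $x,y$ with $y\le x$; the resulting partial operation $*$ (defined on exactly the pairs $(x,y)$ with $y\le x$) is the sectional pseudocomplementation of $P$. $(P,\to)$ is a normal ESP-poset if $P$ is sectionally pseudocomplemented and, for all $x,y\in P$, the set $\{z*y: z\in P,\ x\le z,\ y\le z\}$ has a greatest element and $x\to y$ is equal to it. A maximal lower bound of $x$ and $y$ is a maximal element of the set of common lower bounds of $x$ and $y$ in $P$. *)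

theory Defs
  imports Main
begin

definition is_greatest :: "'a::order \<Rightarrow> 'a set \<Rightarrow> bool" where
  "is_greatest g A \<longleftrightarrow> g \<in> A \<and> (\<forall>a\<in>A. a \<le> g)"

definition is_maximal :: "'a::order \<Rightarrow> 'a set \<Rightarrow> bool" where
  "is_maximal m A \<longleftrightarrow> m \<in> A \<and> (\<forall>a\<in>A. m \<le> a \<longrightarrow> a = m)"

definition common_lower_bounds :: "'a::order \<Rightarrow> 'a \<Rightarrow> 'a set" where
  "common_lower_bounds x y = {w. w \<le> x \<and> w \<le> y}"

definition is_maximal_lower_bound :: "'a::order \<Rightarrow> 'a \<Rightarrow> 'a \<Rightarrow> bool" where
  "is_maximal_lower_bound z x y \<longleftrightarrow> is_maximal z (common_lower_bounds x y)"

(* {y..} is the section [y) of the poset formed by the whole type. *)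
definition section_disjoint :: "'a::order \<Rightarrow> 'a \<Rightarrow> 'a set" where
  "section_disjoint x y = {u \<in> {y..}. common_lower_bounds u x \<inter> {y..} = {y}}"

definition sectionally_pseudocomplemented :: "'a::order itself \<Rightarrow> bool" where
  "sectionally_pseudocomplemented _ \<longleftrightarrow>
     (\<forall>x y :: 'a. y \<le> x \<longrightarrow> (\<exists>u. is_greatest u (section_disjoint x y)))"

(* x * y as a total function; its value is meaningful only if y \<le> x and the greatest
   element exists. *)
definition sec_pc :: "'a::order \<Rightarrow> 'a \<Rightarrow> 'a" where
  "sec_pc x y = (THE u. is_greatest u (section_disjoint x y))"

definition normal_ESP_poset :: "('a::order \<Rightarrow> 'a \<Rightarrow> 'a) \<Rightarrow> bool" where
  "normal_ESP_poset imp \<longleftrightarrow>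
     sectionally_pseudocomplemented TYPE('a) \<and>
     (\<forall>x y. is_greatest (imp x y) {sec_pc z y | z. x \<le> z \<and> y \<le> z})"

end

theory Submission
  imports Defs
begin

text \<open>
  In a normal ESP-poset, a value x \<rightarrow> y is w * y for some common upper bound w of x and y, and the
  relation "u is disjoint from w in [y)" is symmetric in u and w; this symmetry is exchange law (1).
  Conversely, (1) and (2) say that x \<rightarrow> y is disjoint from x in [y) when y \<le> x, while (3) makes it
  the greatest such element. For arbitrary x, y, the element z = (x \<rightarrow> y) \<rightarrow> y is a common upper
  bound with z \<rightarrow> y = x \<rightarrow> y, so the required greatest element is attained at z.
\<close>

lemma is_greatest_unique: "is_greatest u A \<Longrightarrow> is_greatest v A \<Longrightarrow> u = v"
  by (simp add: is_greatest_def order_antisym)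

lemma sec_pc_eqI: "is_greatest u (section_disjoint x y) \<Longrightarrow> sec_pc x y = u"
  unfolding sec_pc_def by (rule the_equality, assumption, rule is_greatest_unique)

lemma section_disjoint_iff:
  "u \<in> section_disjoint x y \<longleftrightarrow> y \<le> u \<and> y \<le> x \<and> (\<forall>w. w \<le> u \<longrightarrow> w \<le> x \<longrightarrow> y \<le> w \<longrightarrow> w = y)"
  unfolding section_disjoint_def common_lower_bounds_def by auto

lemma section_disjoint_sym: "u \<in> section_disjoint x y \<Longrightarrow> x \<in> section_disjoint u y"
  unfolding section_disjoint_iff by blast

text \<open>This is the link to condition (3), which thereby says that \<open>imp x y\<close> bounds
  everything disjoint from \<open>x\<close> in the section of \<open>y\<close>.\<close>

lemma section_disjoint_iff_maximal_lower_bound: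
  "u \<in> section_disjoint x y \<longleftrightarrow> is_maximal_lower_bound y u x"
  unfolding section_disjoint_iff is_maximal_lower_bound_def is_maximal_def common_lower_bounds_def
  by auto

lemma normal_ESP_sec_pc:
  fixes imp :: "'a::order \<Rightarrow> 'a \<Rightarrow> 'a" and x y :: 'a
  assumes "normal_ESP_poset imp" and "y \<le> x"
  shows "is_greatest (sec_pc x y) (section_disjoint x y)"
proof -
  obtain u where "is_greatest u (section_disjoint x y)"
    using assms unfolding normal_ESP_poset_def sectionally_pseudocomplemented_def by blast
  then show ?thesis
    by (simp add: sec_pc_eqI)
qed

lemma normal_ESP_imp_obtain:
  assumes "normal_ESP_poset imp"
  obtains z where "x \<le> z" and "y \<le> z" and "imp x y \<in> section_disjoint z y"
proof -
  obtain z where "x \<le> z" "y \<le> z" "imp x y = sec_pc z y"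
    using assms unfolding normal_ESP_poset_def is_greatest_def by blast
  then show thesis
    using that normal_ESP_sec_pc[OF assms, of y z] by (simp add: is_greatest_def)
qed

text \<open>Together with \<open>normal_ESP_imp_obtain\<close> this describes \<open>imp x y\<close>
  as the greatest element of the union of the sets \<open>section_disjoint z y\<close> over all
  common upper bounds \<open>z\<close> of \<open>x\<close> and \<open>y\<close>, so that
  \<open>sec_pc\<close> need not be mentioned again in deriving the conditions.\<close>

lemma normal_ESP_le_imp:
  assumes "normal_ESP_poset imp" and "x \<le> z" and "u \<in> section_disjoint z y"
  shows "u \<le> imp x y"
proof -
  have "y \<le> z"
    using assms(3) unfolding section_disjoint_iff by blast
  then have "u \<le> sec_pc z y"
    using normal_ESP_sec_pc[OF assms(1), of y z] assms(3) by (simp add: is_greatest_def)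
  also have "sec_pc z y \<le> imp x y"
  proof -
    have "is_greatest (imp x y) {sec_pc z y | z. x \<le> z \<and> y \<le> z}"
      using assms(1) by (simp add: normal_ESP_poset_def)
    then show ?thesis
      using assms(2) \<open>y \<le> z\<close> by (auto simp: is_greatest_def)
  qed
  finally show ?thesis .
qed

lemma normal_ESP_le:
  assumes "normal_ESP_poset imp"
  shows "y \<le> imp x y"
proof -
  obtain z where "imp x y \<in> section_disjoint z y"
    by (rule normal_ESP_imp_obtain[OF assms])
  then show ?thesis
    unfolding section_disjoint_iff by blast
qed

lemma normal_ESP_exchange:
  assumes "normal_ESP_poset imp" and "x \<le> imp y z"
  shows "y \<le> imp x z"
proof -
  obtain w where w: "y \<le> w" "imp y z \<in> section_disjoint w z"
    by (rule normal_ESP_imp_obtain[OF assms(1)])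
  \<comment> \<open>The element \<open>imp y z\<close> now serves as the upper bound of
    \<open>x\<close>, and by symmetry \<open>w\<close> is disjoint from it.\<close>
  then have "w \<le> imp x z"
    using normal_ESP_le_imp[OF assms(1) assms(2) section_disjoint_sym] by simp
  with w(1) show ?thesis by (rule order_trans)
qed

lemma normal_ESP_le_of_le_imp:
  assumes "normal_ESP_poset imp" and "y \<le> x" and "x \<le> imp x y"
  shows "x \<le> y"
proof -
  obtain w where "x \<le> w" "imp x y \<in> section_disjoint w y"
    by (rule normal_ESP_imp_obtain[OF assms(1)])
  \<comment> \<open>Here \<open>x\<close> itself is a common lower bound of \<open>imp x y\<close>
    and \<open>w\<close> in the section of \<open>y\<close>.\<close>
  then have "x = y"
    using assms(2,3) unfolding section_disjoint_iff by blast
  then show ?thesis by simp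
qed

lemma normal_ESP_maximal_lower_bound:
  assumes "normal_ESP_poset imp" and "is_maximal_lower_bound z x y"
  shows "x \<le> imp y z"
  using normal_ESP_le_imp[OF assms(1) order_refl] assms(2)
  by (simp add: section_disjoint_iff_maximal_lower_bound)

text \<open>Any \<open>v\<close> has a common upper bound with \<open>x\<close>, because the set
  defining \<open>imp v x\<close> is nonempty. Everything above \<open>x\<close> is disjoint from
  \<open>x\<close> in the section of \<open>x\<close>, hence lies below
  \<open>imp x x\<close>.\<close>

lemma normal_ESP_greatest:
  fixes imp :: "'a::order \<Rightarrow> 'a \<Rightarrow> 'a"
  assumes "normal_ESP_poset imp"
  shows "is_greatest (imp x x) UNIV"
proof -
  have "v \<le> imp x x" for v
  proof -
    obtain z where "v \<le> z" "x \<le> z"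
      by (rule normal_ESP_imp_obtain[OF assms])
    moreover have "z \<in> section_disjoint x x"
      using \<open>x \<le> z\<close> by (auto simp: section_disjoint_iff)
    then have "z \<le> imp x x"
      using normal_ESP_le_imp[OF assms order_refl] by blast
    ultimately show ?thesis by simp
  qed
  then show ?thesis by (simp add: is_greatest_def)
qed

lemma normal_ESP_posetI:
  fixes imp :: "'a::order \<Rightarrow> 'a \<Rightarrow> 'a"
  assumes le_imp: "\<And>x y. y \<le> imp x y"
    and exchange: "\<And>x y z. x \<le> imp y z \<Longrightarrow> y \<le> imp x z"
    and le_of_le_imp: "\<And>x y. y \<le> x \<Longrightarrow> x \<le> imp x y \<Longrightarrow> x \<le> y"
    and mlb: "\<And>x y z. is_maximal_lower_bound z x y \<Longrightarrow> x \<le> imp y z"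
  shows "normal_ESP_poset imp"
proof -
  have greatest: "is_greatest (imp x y) (section_disjoint x y)" if "y \<le> x" for x y
  proof -
    have "w = y" if w: "w \<le> imp x y" "w \<le> x" "y \<le> w" for w
    proof (rule order_antisym)
      \<comment> \<open>Exchange turns \<open>w \<le> imp x y\<close> into
        \<open>x \<le> imp w y\<close>.\<close>
      have "w \<le> imp w y"
        using w(2) exchange[OF w(1)] by (rule order_trans)
      with w(3) show "w \<le> y" by (rule le_of_le_imp)
    qed (fact w(3))
    then have "imp x y \<in> section_disjoint x y"
      using that le_imp by (simp add: section_disjoint_iff)
    then show ?thesis
      using mlb by (simp add: is_greatest_def section_disjoint_iff_maximal_lower_bound)
  qed
  have sec_pc: "sec_pc x y = imp x y" if "y \<le> x" for x y
    using greatest[OF that] by (rule sec_pc_eqI)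
  \<comment> \<open>Exchange makes \<open>\<lambda>x. imp x y\<close> a Galois connection with
    itself: reflexivity gives \<open>z \<le> imp (imp z y) y\<close>, and exchanging
    \<open>x \<le> imp (imp z y) y\<close> back yields the claim.\<close>
  have antimono: "imp z y \<le> imp x y" if "x \<le> z" for x y z
    by (rule exchange[OF order_trans[OF that exchange[OF order_refl]]])
  have "is_greatest (imp x y) {sec_pc z y | z. x \<le> z \<and> y \<le> z}" for x y
  proof -
    let ?z = "imp (imp x y) y"
    have "x \<le> ?z" "imp x y \<le> imp ?z y"
      by (rule exchange, rule order_refl)+
    \<comment> \<open>This is the analogue of the law that triple negation equals single
      negation.\<close>
    from this(2) antimono[OF this(1)] have "imp x y = imp ?z y"
      by (rule order_antisym)
    then have "imp x y = sec_pc ?z y"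
      using sec_pc[OF le_imp] by (rule trans[OF _ sym])
    then have "imp x y \<in> {sec_pc z y | z. x \<le> z \<and> y \<le> z}"
      using \<open>x \<le> ?z\<close> le_imp by blast
    moreover have "sec_pc z y \<le> imp x y" if "x \<le> z" "y \<le> z" for z
      unfolding sec_pc[OF that(2)] using that(1) by (rule antimono)
    ultimately show ?thesis
      unfolding is_greatest_def by blast
  qed
  then show ?thesis
    using greatest unfolding normal_ESP_poset_def sectionally_pseudocomplemented_def by blast
qed

text \<open>Below the top \<open>t\<close>, the element \<open>y\<close> is the greatest lower bound
  of \<open>t\<close> and \<open>y\<close>, so (3) puts \<open>t\<close>, and hence every
  \<open>x\<close>, below \<open>imp y y\<close>; exchange then swaps \<open>x\<close> and the first
  \<open>y\<close>.\<close>

lemma le_imp_of_greatest: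
  fixes imp :: "'a::order \<Rightarrow> 'a \<Rightarrow> 'a"
  assumes "is_greatest t (UNIV :: 'a set)"
    and exchange: "\<And>x y z. x \<le> imp y z \<Longrightarrow> y \<le> imp x z"
    and mlb: "\<And>x y z. is_maximal_lower_bound z x y \<Longrightarrow> x \<le> imp y z"
  shows "y \<le> imp x y"
proof -
  have t: "v \<le> t" for v
    using assms(1) by (simp add: is_greatest_def)
  then have "is_maximal_lower_bound y t y"
    by (auto simp: is_maximal_lower_bound_def is_maximal_def common_lower_bounds_def)
  then have "x \<le> imp y y"
    by (rule order_trans[OF t mlb])
  then show ?thesis by (rule exchange)
qed

theorem theorem6p9:
  fixes imp :: "'a::order \<Rightarrow> 'a \<Rightarrow> 'a"
  shows "(normal_ESP_poset imp \<longleftrightarrow>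
            (\<forall>x y. y \<le> imp x y) \<and>
            (\<forall>x y z. x \<le> imp y z \<longrightarrow> y \<le> imp x z) \<and>
            (\<forall>x y. y \<le> x \<and> x \<le> imp x y \<longrightarrow> x \<le> y) \<and>
            (\<forall>x y z. is_maximal_lower_bound z x y \<longrightarrow> x \<le> imp y z))
       \<and> (normal_ESP_poset imp \<longleftrightarrow>
            (\<exists>t::'a. is_greatest t UNIV) \<and>
            (\<forall>x y z. x \<le> imp y z \<longrightarrow> y \<le> imp x z) \<and>
            (\<forall>x y. y \<le> x \<and> x \<le> imp x y \<longrightarrow> x \<le> y) \<and>
            (\<forall>x y z. is_maximal_lower_bound z x y \<longrightarrow> x \<le> imp y z))"
proof -
  let ?exchange = "\<forall>x y z. x \<le> imp y z \<longrightarrow> y \<le> imp x z"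
  let ?contract = "\<forall>x y. y \<le> x \<and> x \<le> imp x y \<longrightarrow> x \<le> y"
  let ?mlb = "\<forall>x y z. is_maximal_lower_bound z x y \<longrightarrow> x \<le> imp y z"
  have necessary: "(\<forall>x y. y \<le> imp x y) \<and> (\<exists>t::'a. is_greatest t UNIV) \<and>
    ?exchange \<and> ?contract \<and> ?mlb"
    if N: "normal_ESP_poset imp"
    by (intro conjI allI impI exI; (elim conjE)?)
      (fact normal_ESP_le[OF N] normal_ESP_greatest[OF N] normal_ESP_exchange[OF N]
        normal_ESP_le_of_le_imp[OF N] normal_ESP_maximal_lower_bound[OF N])+
  have sufficient: "normal_ESP_poset imp"
    if "\<forall>x y. y \<le> imp x y" "?exchange" "?contract" "?mlb"
    by (rule normal_ESP_posetI)
      (fact that(1)[rule_format] that(2)[rule_format] that(3)[rule_format, OF conjI] that(4)[rule_format])+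
  have le: "\<forall>x y. y \<le> imp x y" if "\<exists>t::'a. is_greatest t UNIV" "?exchange" "?mlb"
  proof -
    from that(1) obtain t :: 'a where t: "is_greatest t UNIV" ..
    have "y \<le> imp x y" for x y
      by (rule le_imp_of_greatest[OF t]) (fact that(2)[rule_format] that(3)[rule_format])+
    then show ?thesis by (intro allI)
  qed
  from necessary sufficient le show ?thesis by satx
qed

end
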